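(* Let $a,b,p,q$ be real numbers with $p^2+4q>0$ and $q\neq 0$, and let $\alpha,\beta$ be the roots of $t^2-pt-q=0$ with $\alpha-\beta=\sqrt{p^2+4q}$. Put $A=b-a\beta$, $B=b-a\alpha$ and $\boldsymbol{\omega}=(1-p)\mathbf{i}-q\boldsymbol{\varepsilon}+(p^{2}+q+1)\mathbf{h}$. Then for every integer $m$, $$\mathbb{H}\mathcal{J}_{m}^{2}-\mathbb{H}\mathcal{J}_{m+1}\mathbb{H}\mathcal{J}_{m-1}=AB(-q)^{m-1}\left[\left(\mathbb{H}\mathcal{L}_{0}-(q^{3}+pq-q+1)\right)+pq(\mathbb{H}\mathcal{F}_{0}-\boldsymbol{\omega})\right].$$
   Context: The hybrid numbers $\mathbb{K}$ are the 4-dimensional associative unital real algebra with basis $1,\mathbf{i},\boldsymbol{\varepsilon},\mathbf{h}$ and multiplication $\mathbf{i}^2=-1$, $\boldsymbol{\varepsilon}^2=0$, $\mathbf{h}^2=1$, $\mathbf{i}\boldsymbol{\varepsilon}=1-\mathbf{h}$, $\boldsymbol{\varepsilon}\mathbf{i}=1+\mathbf{h}$, $\mathbf{i}\mathbf{h}=\boldsymbol{\varepsilon}+\mathbf{i}$, $\mathbf{h}\mathbf{i}=-(\boldsymbol{\varepsilon}+\mathbf{i})$, $\boldsymbol{\varepsilon}\mathbf{h}=-\boldsymbol{\varepsilon}$, $\mathbf{h}\boldsymbol{\varepsilon}=\boldsymbol{\varepsilon}$. Real numbers are identified with real multiples of $1$. The generalized hybrid Fibonacci numbers with real parameters $a,b,p,q$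 are defined by $\mathbb{H}\mathcal{J}_{n}=p\mathbb{H}\mathcal{J}_{n-1}+q\mathbb{H}\mathcal{J}_{n-2}$, with $\mathbb{H}\mathcal{J}_{0}=a+b\mathbf{i}+(pb+qa)\boldsymbol{\varepsilon}+((p^{2}+q)b+pqa)\mathbf{h}$ and $\mathbb{H}\mathcal{J}_{1}=b+(pb+qa)\mathbf{i}+((p^{2}+q)b+pqa)\boldsymbol{\varepsilon}+((p^{3}+2pq)b+q(p^{2}+q)a)\mathbf{h}$; for negative indices the sequence is extended by the same recurrence (using $q\neq0$). The $(p,q)$-Fibonacci numbers: $\mathcal{F}_0=0$, $\mathcal{F}_1=1$, $\mathcal{F}_n=p\mathcal{F}_{n-1}+q\mathcal{F}_{n-2}$. The $(p,q)$-Lucas numbers: $\mathcal{L}_0=2$, $\mathcal{L}_1=p$, $\mathcal{L}_n=p\mathcal{L}_{n-1}+q\mathcal{L}_{n-2}$. The hybrid versions are $\mathbb{H}\mathcal{F}_{n}=\mathcal{F}_{n}+\mathcal{F}_{n+1}\mathbf{i}+\mathcal{F}_{n+2}\boldsymbol{\varepsilon}+\mathcal{F}_{n+3}\mathbf{h}$ and $\mathbb{H}\mathcal{L}_{n}=\mathcal{L}_{n}+\mathcal{L}_{n+1}\mathbf{i}+\mathcal{L}_{n+2}\boldsymbol{\varepsilon}+\mathcal{L}_{n+3}\mathbf{h}$. *)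

theory Defs
  imports Complex_Main
begin

text \<open>
  \<open>Hybrid x0 x1 x2 x3\<close> stands for \<open>x0 + x1 i + x2 \<epsilon> + x3 h\<close>.
  The product below is the bilinear extension of the multiplication table that is
  recovered in the lemma \<open>hybrid_mult_table\<close>.
\<close>

datatype hybrid =
  Hybrid (hre: real) (him: real) (heps: real) (hhyp: real)

lemma hybrid_eq_iff:
  "x = y \<longleftrightarrow> hre x = hre y \<and> him x = him y \<and> heps x = heps y \<and> hhyp x = hhyp y"
  by (cases x; cases y) simp

instantiation hybrid :: real_algebra_1
begin

definition "0 = Hybrid 0 0 0 0"
definition "1 = Hybrid 1 0 0 0"
definition "x + y = Hybrid (hre x + hre y) (him x + him y) (heps x + heps y) (hhyp x + hhyp y)"
definition "- x = Hybrid (- hre x) (- him x) (- heps x) (- hhyp x)"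
definition "x - (y::hybrid) = x + (- y)"
definition "scaleR r x = Hybrid (r * hre x) (r * him x) (r * heps x) (r * hhyp x)"
definition "x * y = Hybrid
  (hre x * hre y - him x * him y + hhyp x * hhyp y + him x * heps y + heps x * him y)
  (hre x * him y + him x * hre y + him x * hhyp y - hhyp x * him y)
  (hre x * heps y + heps x * hre y + him x * hhyp y - hhyp x * him y
     - heps x * hhyp y + hhyp x * heps y)
  (hre x * hhyp y + hhyp x * hre y - him x * heps y + heps x * him y)"

instance
  by standard
    (simp_all add: hybrid_eq_iff zero_hybrid_def one_hybrid_def plus_hybrid_def uminus_hybrid_def
      minus_hybrid_def scaleR_hybrid_def times_hybrid_def algebra_simps)

end

definition hi :: hybrid where "hi = Hybrid 0 1 0 0"
definition heps_unit :: hybrid where "heps_unit = Hybrid 0 0 1 0"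
definition hh :: hybrid where "hh = Hybrid 0 0 0 1"

lemma hybrid_mult_table:
  "hi * hi = - 1" "heps_unit * heps_unit = 0" "hh * hh = 1"
  "hi * heps_unit = 1 - hh" "heps_unit * hi = 1 + hh"
  "hi * hh = heps_unit + hi" "hh * hi = - (heps_unit + hi)"
  "heps_unit * hh = - heps_unit" "hh * heps_unit = heps_unit"
  by (simp_all add: hybrid_eq_iff hi_def heps_unit_def hh_def zero_hybrid_def one_hybrid_def
      plus_hybrid_def uminus_hybrid_def minus_hybrid_def times_hybrid_def)

definition hybrid_of :: "real \<Rightarrow> real \<Rightarrow> real \<Rightarrow> real \<Rightarrow> hybrid" where
  "hybrid_of x0 x1 x2 x3 = of_real x0 + x1 *\<^sub>R hi + x2 *\<^sub>R heps_unit + x3 *\<^sub>R hh"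

lemma hybrid_of_eq: "hybrid_of x0 x1 x2 x3 = Hybrid x0 x1 x2 x3"
  by (simp add: hybrid_of_def of_real_def hi_def heps_unit_def hh_def hybrid_eq_iff
      one_hybrid_def plus_hybrid_def scaleR_hybrid_def)

text \<open>
  Two-sided solution of \<open>x n = p x (n - 1) + q x (n - 2)\<close> with prescribed \<open>x 0\<close> and \<open>x 1\<close>.
  At negative indices the recurrence is solved for its last term, which is meaningful only
  for \<open>q \<noteq> 0\<close>.
\<close>

function rec_seq :: "real \<Rightarrow> real \<Rightarrow> 'a::real_vector \<Rightarrow> 'a \<Rightarrow> int \<Rightarrow> 'a" where
  "rec_seq p q x0 x1 n =
     (if n = 0 then x0
      else if n = 1 then x1
      else if n \<ge> 2 then p *\<^sub>R rec_seq p q x0 x1 (n - 1) + q *\<^sub>R rec_seq p q x0 x1 (n - 2)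
      else (rec_seq p q x0 x1 (n + 2) - p *\<^sub>R rec_seq p q x0 x1 (n + 1)) /\<^sub>R q)"
  by auto
termination
  by (relation "measure (\<lambda>(p, q, x0, x1, n). nat \<bar>2 * n - 1\<bar>)") auto

declare rec_seq.simps [simp del]

lemma rec_seq_0 [simp]: "rec_seq p q x0 x1 0 = x0"
  and rec_seq_1 [simp]: "rec_seq p q x0 x1 1 = x1"
  by (simp_all add: rec_seq.simps)

lemma rec_seq_rec:
  assumes "q \<noteq> 0"
  shows "rec_seq p q x0 x1 n = p *\<^sub>R rec_seq p q x0 x1 (n - 1) + q *\<^sub>R rec_seq p q x0 x1 (n - 2)"
proof (cases "n \<ge> 2")
  case True
  then show ?thesis by (subst rec_seq.simps) simp
next
  case False
  then have "rec_seq p q x0 x1 (n - 2) =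
      (rec_seq p q x0 x1 n - p *\<^sub>R rec_seq p q x0 x1 (n - 1)) /\<^sub>R q"
    by (subst rec_seq.simps) (simp add: algebra_simps)
  then show ?thesis using assms by simp
qed

definition pq_fib :: "real \<Rightarrow> real \<Rightarrow> int \<Rightarrow> real" where
  "pq_fib p q = rec_seq p q 0 1"

definition pq_lucas :: "real \<Rightarrow> real \<Rightarrow> int \<Rightarrow> real" where
  "pq_lucas p q = rec_seq p q 2 p"

definition hybrid_fib :: "real \<Rightarrow> real \<Rightarrow> int \<Rightarrow> hybrid" where
  "hybrid_fib p q n =
     hybrid_of (pq_fib p q n) (pq_fib p q (n + 1)) (pq_fib p q (n + 2)) (pq_fib p q (n + 3))"

definition hybrid_lucas :: "real \<Rightarrow> real \<Rightarrow> int \<Rightarrow> hybrid" where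
  "hybrid_lucas p q n =
     hybrid_of (pq_lucas p q n) (pq_lucas p q (n + 1)) (pq_lucas p q (n + 2)) (pq_lucas p q (n + 3))"

definition gen_hybrid_fib :: "real \<Rightarrow> real \<Rightarrow> real \<Rightarrow> real \<Rightarrow> int \<Rightarrow> hybrid" where
  "gen_hybrid_fib a b p q = rec_seq p q
     (hybrid_of a b (p * b + q * a) ((p\<^sup>2 + q) * b + p * q * a))
     (hybrid_of b (p * b + q * a) ((p\<^sup>2 + q) * b + p * q * a)
        ((p ^ 3 + 2 * p * q) * b + q * (p\<^sup>2 + q) * a))"

end

theory Submission
  imports Defs
begin

text \<open>
  For any two-sided sequence \<open>x (n + 1) = p x n + q x (n - 1)\<close> in an associative algebra, commutative
  or not, \<open>D n = (x n)\<^sup>2 - x (n + 1) x (n - 1)\<close> satisfies \<open>D n = - q D (n - 1)\<close>: expand the outer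
  factor of \<open>D n\<close> by the recurrence and then recombine \<open>x n - p x (n - 1) = q x (n - 2)\<close>.
  So \<open>D m\<close> is \<open>(- q) ^ (m - 1)\<close> times the value at \<open>m = 1\<close>, a polynomial identity.
\<close>

lemma cassini_step:
  fixes x :: "int \<Rightarrow> 'a::real_algebra_1"
  assumes rec: "\<And>n. x n = p *\<^sub>R x (n - 1) + q *\<^sub>R x (n - 2)"
  shows "(x (n + 1))\<^sup>2 - x (n + 2) * x n = (- q) *\<^sub>R ((x n)\<^sup>2 - x (n + 1) * x (n - 1))"
proof -
  have up: "x (n + 2) = p *\<^sub>R x (n + 1) + q *\<^sub>R x n"
    using rec[of "n + 2"] by (simp add: add.commute)
  have "x (n + 1) = p *\<^sub>R x n + q *\<^sub>R x (n - 1)"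
    using rec[of "n + 1"] by simp
  then have down: "x (n + 1) - p *\<^sub>R x n = q *\<^sub>R x (n - 1)"
    by simp
  \<comment> \<open>Expanding the left factor \<open>x (n + 2)\<close> leaves
    \<open>x (n + 1)\<close> on the left in both remaining products, so it factors out without
    commuting anything.\<close>
  have "(x (n + 1))\<^sup>2 - x (n + 2) * x n = x (n + 1) * (x (n + 1) - p *\<^sub>R x n) - q *\<^sub>R (x n)\<^sup>2"
    by (simp add: up power2_eq_square algebra_simps)
  also have "\<dots> = (- q) *\<^sub>R ((x n)\<^sup>2 - x (n + 1) * x (n - 1))"
    unfolding down by (simp add: algebra_simps)
  finally show ?thesis .
qed

text \<open>The induction starts at 1, where the exponent \<open>m - 1\<close> vanishes, and runs in
  both directions.\<close>

lemma cassini_general: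
  fixes x :: "int \<Rightarrow> 'a::real_algebra_1"
  assumes "q \<noteq> 0"
    and rec: "\<And>n. x n = p *\<^sub>R x (n - 1) + q *\<^sub>R x (n - 2)"
  shows "(x m)\<^sup>2 - x (m + 1) * x (m - 1) = (- q) powi (m - 1) *\<^sub>R ((x 1)\<^sup>2 - x 2 * x 0)"
proof (induction m rule: int_induct[where k = 1])
  case base
  then show ?case by simp
next
  case (step1 i)
  have "(- q) powi i = (- q) * (- q) powi (i - 1)"
    using power_int_add_1'[of "- q" "i - 1"] \<open>q \<noteq> 0\<close> by simp
  then show ?case
    using cassini_step[of x p q i, OF rec] step1 by (simp add: add.commute)
next
  case (step2 i)
  have "(- q) powi (i - 1) = (- q) * (- q) powi (i - 2)"
    using power_int_add_1'[of "- q" "i - 2"] \<open>q \<noteq> 0\<close> by simp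
  \<comment> \<open>Going down, the step from \<open>i - 1\<close> to \<open>i\<close> is read
    backwards; the common factor \<open>- q\<close> is then cancelled.\<close>
  then have "(- q) *\<^sub>R ((x (i - 1))\<^sup>2 - x i * x (i - 2))
      = (- q) *\<^sub>R ((- q) powi (i - 2) *\<^sub>R ((x 1)\<^sup>2 - x 2 * x 0))"
    using cassini_step[of x p q "i - 1", OF rec] step2 by (simp add: add.commute)
  then have "(x (i - 1))\<^sup>2 - x i * x (i - 2) = (- q) powi (i - 2) *\<^sub>R ((x 1)\<^sup>2 - x 2 * x 0)"
    using \<open>q \<noteq> 0\<close> by (metis neg_equal_0_iff_equal scaleR_left_imp_eq)
  then show ?case by simp
qed

lemma rec_seq_2: "rec_seq p q x0 x1 2 = p *\<^sub>R x1 + q *\<^sub>R x0"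
  by (simp add: rec_seq.simps[of _ _ _ _ 2])

lemma rec_seq_3: "rec_seq p q x0 x1 3 = p *\<^sub>R (p *\<^sub>R x1 + q *\<^sub>R x0) + q *\<^sub>R x1"
  by (simp add: rec_seq.simps[of _ _ _ _ 3] rec_seq_2)

text \<open>The scalar is \<open>A * B\<close> with the roots eliminated by Vieta. Only indices 0 to
  3 occur, so each of the four coordinates is a polynomial identity in \<open>a\<close>,
  \<open>b\<close>, \<open>p\<close>, \<open>q\<close>.\<close>

lemma gen_hybrid_fib_cassini_1:
  "(gen_hybrid_fib a b p q 1)\<^sup>2 - gen_hybrid_fib a b p q 2 * gen_hybrid_fib a b p q 0
    = (b\<^sup>2 - a * b * p - a\<^sup>2 * q) *\<^sub>R
        ((hybrid_lucas p q 0 - of_real (q ^ 3 + p * q - q + 1))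
          + (p * q) *\<^sub>R (hybrid_fib p q 0
              - ((1 - p) *\<^sub>R hi - q *\<^sub>R heps_unit + (p\<^sup>2 + q + 1) *\<^sub>R hh)))"
  unfolding gen_hybrid_fib_def hybrid_lucas_def hybrid_fib_def pq_lucas_def pq_fib_def
  by (simp add: rec_seq_2 rec_seq_3 hybrid_of_eq of_real_def hi_def heps_unit_def hh_def
      hybrid_eq_iff one_hybrid_def plus_hybrid_def uminus_hybrid_def minus_hybrid_def
      scaleR_hybrid_def times_hybrid_def power2_eq_square power3_eq_cube)
    (intro conjI; algebra)

theorem corollary2p5:
  fixes a b p q \<alpha> \<beta> A B :: real and \<omega> :: hybrid and m :: int
  assumes "p\<^sup>2 + 4 * q > 0" and "q \<noteq> 0"
    and "\<alpha>\<^sup>2 - p * \<alpha> - q = 0" and "\<beta>\<^sup>2 - p * \<beta> - q = 0"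
    and "\<alpha> - \<beta> = sqrt (p\<^sup>2 + 4 * q)"
    and "A = b - a * \<beta>" and "B = b - a * \<alpha>"
    and "\<omega> = (1 - p) *\<^sub>R hi - q *\<^sub>R heps_unit + (p\<^sup>2 + q + 1) *\<^sub>R hh"
  shows "(gen_hybrid_fib a b p q m)\<^sup>2
           - gen_hybrid_fib a b p q (m + 1) * gen_hybrid_fib a b p q (m - 1)
         = (A * B * (- q) powi (m - 1)) *\<^sub>R
             ((hybrid_lucas p q 0 - of_real (q ^ 3 + p * q - q + 1))
               + (p * q) *\<^sub>R (hybrid_fib p q 0 - \<omega>))"
proof -
  have "\<alpha> \<noteq> \<beta>"
    using assms(1,5) by auto
  \<comment> \<open>This is the difference of the two root equations.\<close>
  moreover have "(\<alpha> - \<beta>) * (\<alpha> + \<beta> - p) = 0"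
    using assms(3,4) by algebra
  ultimately have sum: "\<alpha> + \<beta> = p"
    by simp
  \<comment> \<open>Putting \<open>\<alpha> + \<beta>\<close> for \<open>p\<close> in the equation
    of \<alpha> cancels its square.\<close>
  have prod: "\<alpha> * \<beta> = - q"
    using assms(3) unfolding sum[symmetric] by (simp add: power2_eq_square algebra_simps)
  have "A * B = b\<^sup>2 - a * b * (\<alpha> + \<beta>) + a\<^sup>2 * (\<alpha> * \<beta>)"
    by (simp add: assms(6,7) power2_eq_square algebra_simps)
  then have AB: "A * B = b\<^sup>2 - a * b * p - a\<^sup>2 * q"
    by (simp add: sum prod)
  have "gen_hybrid_fib a b p q n
      = p *\<^sub>R gen_hybrid_fib a b p q (n - 1) + q *\<^sub>R gen_hybrid_fib a b p q (n - 2)" for n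
    unfolding gen_hybrid_fib_def using \<open>q \<noteq> 0\<close> by (rule rec_seq_rec)
  from cassini_general[of q "gen_hybrid_fib a b p q", OF \<open>q \<noteq> 0\<close> this, of m]
  show ?thesis
    by (simp add: gen_hybrid_fib_cassini_1 AB assms(8) mult.commute)
qed

end
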